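(* Let $\Delta$ be a finite set of defeasible conditionals over $\mathcal{L}(M)$ and $(G,M,I)$ a $\Delta$-valid formal context. Let $\mathbb{R}^\Delta$ be the set of all ranked contexts over $(G,M,I)$ that satisfy $\Delta$, and let $\mathbb{R}^\Delta_{\mathtt{OR}}\in\mathbb{R}^\Delta$ be the ranked context derived from the ObjectRank algorithm applied to $\Delta$ and $(G,M,I)$. Then $\mathbb{R}^\Delta_{\mathtt{OR}}$ is the unique $\preceq_{\mathbb{R}}$-minimum element of $\mathbb{R}^\Delta$; that is, $\mathbb{R}^\Delta_{\mathtt{OR}}\preceq_{\mathbb{R}}\mathbb{R}_1$ for every $\mathbb{R}_1\in\mathbb{R}^\Delta$, and it is the only element of $\mathbb{R}^\Delta$ with this property.
   Context: A formal context is a triple $(G,M,I)$ with $G$ a set of objects, $M$ a set of attributes, $I\subseteq G\times M$. Compound attributes $\mathcal{L}(M)$ are generated from $m\in M$ by $\neg,\land,\lor$, with extents $m^\downarrow=\{g\mid (g,m)\in I\}$, $(\neg\phi)^\downarrow=G\setminus\phi^\downarrow$, $(\phi\land\psi)^\downarrow=\phi^\downarrow\cap\psi^\downarrow$, $(\phi\lor\psi)^\downarrow=\phi^\downarrow\cup\psi^\downarrow$; $g\Vdash\phi$ means $g\in\phi^\downarrow$. A defeasible conditional is an expression $\phi\mathrel{|\!\sim}\psi$ with $\phi,\psi\in\mathcal{L}(M)$; its material counterpart is $\phi\rightarrow\psi$. For $g\in G$: $g\models\phi\rightarrow\psi$ iff $g\notin\phi^\downarrow$ or $g\in\psi^\downarrow$;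 $g$ satisfies a set of conditionals iff it satisfies all their material counterparts. Ranked context: $(G,M,I,\mathsf{R})$ with a ranking function $\mathsf{R}:G\to\mathbb{N}$ that is convex (if $\mathsf{R}(g)=i$ then for each $0\le j<i$ there is $h\in G$ with $\mathsf{R}(h)=j$). It satisfies $\phi\mathrel{|\!\sim}\psi$ iff every $g\in\phi^\downarrow$ of minimal rank among elements of $\phi^\downarrow$ lies in $\psi^\downarrow$; it satisfies $\Delta$ iff it satisfies every member. Write $\mathbb{R}(g)$ for $\mathsf{R}(g)$. For ranked contexts over the same $(G,M,I)$: $\mathbb{R}_1\preceq_{\mathbb{R}}\mathbb{R}_2$ iff $\mathbb{R}_1(g)\le\mathbb{R}_2(g)$ for all $g\in G$. $(G,M,I)$ is $\Delta$-valid iff for every non-empty $\Delta'\subseteq\Delta$ there is $g\in G$ with $g\models\Delta'$ and some $\phi\mathrel{|\!\sim}\psi\in\Delta'$ with $g\in\phi^\downarrow$. ObjectRank (input: finite $\Delta$ and a $\Delta$-valid $(G,M,I)$): set $R_0:=G$, $\Delta_0:=\{\phi\rightarrow\psi\mid\phi\mathrel{|\!\sim}\psi\in\Delta\}$, $i:=0$. While $\Delta_i\neq\emptyset$: let $R_{i+1}:=\{g\in R_i\mid g\not\models\phi\rightarrow\psi\text{ for some }\phi\rightarrow\psi\in\Delta_i\}$; replace $R_i$ by $R_i\setminus R_{i+1}$; let $\Delta_{i+1}:=\Delta_i\setminus\{\phi\rightarrow\psi\in\Delta_i\mid\exists g\in R_i,\ g\Vdash\phi\}$ (with the updated $R_i$);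 $i:=i+1$. On termination the non-empty sets among $R_0,\dots,R_i$ partition $G$ (only the last, $R_i$, may be dropped as empty), and the derived ranked context $\mathbb{R}^\Delta_{\mathtt{OR}}$ has rank $k$ on the elements of $R_k$. *)

theory Defs
  imports Main "HOL-Library.FuncSet" "HOL-Library.While_Combinator"
begin

record ('g, 'm) formal_context =
  objects :: "'g set"
  attributes :: "'m set"
  incidence :: "('g \<times> 'm) set"

definition is_formal_context :: "('g, 'm, 'z) formal_context_scheme \<Rightarrow> bool" where
  "is_formal_context K \<longleftrightarrow> incidence K \<subseteq> objects K \<times> attributes K"

datatype 'm compound =
    Attr 'm
  | Neg "'m compound"
  | Conj "'m compound" "'m compound"
  | Disj "'m compound" "'m compound"

inductive_set lang :: "'m set \<Rightarrow> 'm compound set" for M :: "'m set" where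
  "m \<in> M \<Longrightarrow> Attr m \<in> lang M"
| "\<phi> \<in> lang M \<Longrightarrow> Neg \<phi> \<in> lang M"
| "\<phi> \<in> lang M \<Longrightarrow> \<psi> \<in> lang M \<Longrightarrow> Conj \<phi> \<psi> \<in> lang M"
| "\<phi> \<in> lang M \<Longrightarrow> \<psi> \<in> lang M \<Longrightarrow> Disj \<phi> \<psi> \<in> lang M"

primrec extent :: "('g, 'm, 'z) formal_context_scheme \<Rightarrow> 'm compound \<Rightarrow> 'g set" where
  "extent K (Attr m) = {g. (g, m) \<in> incidence K}"
| "extent K (Neg \<phi>) = objects K - extent K \<phi>"
| "extent K (Conj \<phi> \<psi>) = extent K \<phi> \<inter> extent K \<psi>"
| "extent K (Disj \<phi> \<psi>) = extent K \<phi> \<union> extent K \<psi>"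

datatype 'm conditional = Defeasible "'m compound" "'m compound"

datatype 'm implication = Imp (antecedent: "'m compound") (consequent: "'m compound")

primrec material :: "'m conditional \<Rightarrow> 'm implication" where
  "material (Defeasible \<phi> \<psi>) = Imp \<phi> \<psi>"

definition conditionals :: "'m set \<Rightarrow> 'm conditional set" where
  "conditionals M = {Defeasible \<phi> \<psi> | \<phi> \<psi>. \<phi> \<in> lang M \<and> \<psi> \<in> lang M}"

primrec object_sat ::
  "('g, 'm, 'z) formal_context_scheme \<Rightarrow> 'g \<Rightarrow> 'm implication \<Rightarrow> bool" where
  "object_sat K g (Imp \<phi> \<psi>) \<longleftrightarrow> g \<notin> extent K \<phi> \<or> g \<in> extent K \<psi>"

definition object_sat_all ::
  "('g, 'm, 'z) formal_context_scheme \<Rightarrow> 'g \<Rightarrow> 'm conditional set \<Rightarrow> bool" where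
  "object_sat_all K g \<Delta> \<longleftrightarrow> (\<forall>c\<in>\<Delta>. object_sat K g (material c))"

definition valid_context ::
  "'m conditional set \<Rightarrow> ('g, 'm, 'z) formal_context_scheme \<Rightarrow> bool" where
  "valid_context \<Delta> K \<longleftrightarrow>
    (\<forall>\<Delta>'. \<Delta>' \<subseteq> \<Delta> \<and> \<Delta>' \<noteq> {} \<longrightarrow>
      (\<exists>g\<in>objects K. object_sat_all K g \<Delta>' \<and>
        (\<exists>\<phi> \<psi>. Defeasible \<phi> \<psi> \<in> \<Delta>' \<and> g \<in> extent K \<phi>)))"

record ('g, 'm) ranked_context = "('g, 'm) formal_context" +
  rank :: "'g \<Rightarrow> nat"

text \<open>A ranking function has domain \<open>objects R\<close>; \<open>extensional\<close> fixes its irrelevant values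
  elsewhere, so that equality of ranked contexts is equality of partial rankings.\<close>

definition is_ranked_context :: "('g, 'm) ranked_context \<Rightarrow> bool" where
  "is_ranked_context R \<longleftrightarrow>
    is_formal_context R \<and>
    rank R \<in> extensional (objects R) \<and>
    (\<forall>g\<in>objects R. \<forall>j<rank R g. \<exists>h\<in>objects R. rank R h = j)"

primrec ranked_sat :: "('g, 'm) ranked_context \<Rightarrow> 'm conditional \<Rightarrow> bool" where
  "ranked_sat R (Defeasible \<phi> \<psi>) \<longleftrightarrow>
    (\<forall>g. is_arg_min (rank R) (\<lambda>h. h \<in> extent R \<phi>) g \<longrightarrow> g \<in> extent R \<psi>)"

definition ranked_models ::
  "('g, 'm) formal_context \<Rightarrow> 'm conditional set \<Rightarrow> ('g, 'm) ranked_context set" where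
  "ranked_models K \<Delta> =
    {R. is_ranked_context R \<and> formal_context.truncate R = K \<and> (\<forall>c\<in>\<Delta>. ranked_sat R c)}"

definition rank_le ::
  "('g, 'm) ranked_context \<Rightarrow> ('g, 'm) ranked_context \<Rightarrow> bool" (infix "\<preceq>\<^sub>R" 50) where
  "R1 \<preceq>\<^sub>R R2 \<longleftrightarrow> (\<forall>g\<in>objects R1. rank R1 g \<le> rank R2 g)"

text \<open>A state \<open>(i, R, D)\<close> holds the loop counter and the sequences of the \<open>R\<^sub>k\<close> and of the
  \<open>\<Delta>\<^sub>k\<close>; only the entries with index at most \<open>i\<close> have been assigned.\<close>

type_synonym ('g, 'm) or_state = "nat \<times> (nat \<Rightarrow> 'g set) \<times> (nat \<Rightarrow> 'm implication set)"

definition or_init ::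
  "('g, 'm) formal_context \<Rightarrow> 'm conditional set \<Rightarrow> ('g, 'm) or_state" where
  "or_init K \<Delta> = (0, (\<lambda>_. {})(0 := objects K), (\<lambda>_. {})(0 := material ` \<Delta>))"

definition or_continue :: "('g, 'm) or_state \<Rightarrow> bool" where
  "or_continue = (\<lambda>(i, R, D). D i \<noteq> {})"

definition or_step ::
  "('g, 'm) formal_context \<Rightarrow> ('g, 'm) or_state \<Rightarrow> ('g, 'm) or_state" where
  "or_step K = (\<lambda>(i, R, D).
    let next_R = {g \<in> R i. \<exists>c\<in>D i. \<not> object_sat K g c};
        cur_R = R i - next_R;
        next_D = D i - {c \<in> D i. \<exists>g\<in>cur_R. g \<in> extent K (antecedent c)}
    in (Suc i, R(i := cur_R, Suc i := next_R), D(Suc i := next_D)))"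

definition or_ranked_context ::
  "('g, 'm) formal_context \<Rightarrow> ('g, 'm) or_state \<Rightarrow> ('g, 'm) ranked_context" where
  "or_ranked_context K = (\<lambda>(i, R, D).
    \<lparr>objects = objects K, attributes = attributes K, incidence = incidence K,
     rank = (\<lambda>g\<in>objects K. THE k. k \<le> i \<and> g \<in> R k)\<rparr>)"

text \<open>The result is \<open>None\<close> iff the loop does not terminate.\<close>

definition object_rank ::
  "('g, 'm) formal_context \<Rightarrow> 'm conditional set \<Rightarrow> ('g, 'm) ranked_context option" where
  "object_rank K \<Delta> =
    map_option (or_ranked_context K) (while_option or_continue (or_step K) (or_init K \<Delta>))"

end

theory Submission
  imports Defs
begin

text \<open>Round \<open>k\<close> of the algorithm discards from \<open>\<Delta>\<^sub>k\<close> the implications whose antecedent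
  holds at some object satisfying all of \<open>\<Delta>\<^sub>k\<close>: an object placed in an earlier round makes no
  difference, as the implications whose antecedent it satisfies were discarded in that round. Hence
  the computed rank of \<open>g\<close> is the least \<open>k\<close> such that \<open>g\<close> satisfies \<open>\<Delta>\<^sub>k\<close>. If \<open>R\<^sub>1\<close> is any
  ranked model of \<open>\<Delta>\<close>, induction on the rank shows that an object of rank \<open>k\<close> in \<open>R\<^sub>1\<close>
  satisfies \<open>\<Delta>\<^sub>k\<close>: a violated implication of \<open>\<Delta>\<^sub>k\<close> would have its antecedent true at an object
  of some rank \<open>j < k\<close>, which satisfies \<open>\<Delta>\<^sub>j\<close>, so it would have been discarded in round \<open>j\<close>.\<close>

definition satisfies_all ::
  "('g, 'm, 'z) formal_context_scheme \<Rightarrow> 'g \<Rightarrow> 'm implication set \<Rightarrow> bool" where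
  "satisfies_all K g D \<longleftrightarrow> (\<forall>d\<in>D. object_sat K g d)"

text \<open>These are the sets \<open>\<Delta>_k\<close> of the algorithm, freed from the
  \<open>R_k\<close>: every object is tested in every round, not only those still unplaced.\<close>

primrec residual ::
  "('g, 'm, 'z) formal_context_scheme \<Rightarrow> 'm implication set \<Rightarrow> nat \<Rightarrow> 'm implication set" where
  "residual K D 0 = D"
| "residual K D (Suc n) =
    {c \<in> residual K D n. \<forall>g\<in>objects K.
      satisfies_all K g (residual K D n) \<longrightarrow> g \<notin> extent K (antecedent c)}"

text \<open>\<open>LEAST\<close> is meaningful only if some index qualifies; an index with empty
  residual always does.\<close>

definition level ::
  "('g, 'm, 'z) formal_context_scheme \<Rightarrow> 'm implication set \<Rightarrow> 'g \<Rightarrow> nat" where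
  "level K D g = (LEAST k. satisfies_all K g (residual K D k))"

lemma object_sat_iff:
  "object_sat K g c \<longleftrightarrow> g \<notin> extent K (antecedent c) \<or> g \<in> extent K (consequent c)"
  by (cases c) simp

lemma extent_subset_objects:
  "is_formal_context K \<Longrightarrow> extent K \<phi> \<subseteq> objects K"
  by (induction \<phi>) (auto simp: is_formal_context_def)

lemma extent_truncate: "extent (formal_context.truncate R) \<phi> = extent R \<phi>"
  by (induction \<phi>) (auto simp: formal_context.truncate_def)

lemma residual_antimono: "j \<le> k \<Longrightarrow> residual K D k \<subseteq> residual K D j"
  by (rule lift_Suc_antimono_le[of "residual K D"]) auto

text \<open>Since \<open>j < k\<close>, the implication \<open>c\<close> has survived round
  \<open>j\<close>, where \<open>g\<close> was one of the test objects.\<close>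

lemma antecedent_false_if_residual:
  assumes "g \<in> objects K" "satisfies_all K g (residual K D j)" "j < k" "c \<in> residual K D k"
  shows "g \<notin> extent K (antecedent c)"
proof -
  have "c \<in> residual K D (Suc j)"
    using assms(3,4) residual_antimono[of "Suc j" k K D] by auto
  then show ?thesis using assms(1,2) by simp
qed

text \<open>An implication can only get lost in a particular round, and the object that expels it
  there is the witness.\<close>

lemma removed_witness:
  assumes "c \<in> D" "c \<notin> residual K D k"
  obtains j g where "j < k" "g \<in> objects K" "satisfies_all K g (residual K D j)"
    "g \<in> extent K (antecedent c)"
proof -
  have "\<exists>j<k. \<exists>g\<in>objects K. satisfies_all K g (residual K D j) \<and> g \<in> extent K (antecedent c)"
    using assms
  proof (induction k)
    case (Suc k)
    show ?case
    proof (cases "c \<in> residual K D k")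
      case True
      with Suc.prems show ?thesis by auto
    next
      case False
      with Suc show ?thesis using less_SucI by blast
    qed
  qed simp
  with that show thesis by blast
qed

lemma level_le: "satisfies_all K g (residual K D k) \<Longrightarrow> level K D g \<le> k"
  unfolding level_def by (rule Least_le)

lemma level_satisfies:
  assumes "satisfies_all K g (residual K D k)"
  shows "satisfies_all K g (residual K D (level K D g))"
  unfolding level_def using assms by (rule LeastI)

lemma satisfies_all_empty [simp]: "satisfies_all K g {}"
  by (simp add: satisfies_all_def)

lemma valid_context_implications:
  assumes "valid_context \<Delta> K" "E \<subseteq> material ` \<Delta>" "E \<noteq> {}"
  obtains g c where "g \<in> objects K" "satisfies_all K g E" "c \<in> E" "g \<in> extent K (antecedent c)"
proof -
  \<comment> \<open>Validity speaks of conditionals, so \<open>E\<close> is pulled back along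
    \<open>material\<close>.\<close>
  let ?\<Delta>' = "{c \<in> \<Delta>. material c \<in> E}"
  have E: "E = material ` ?\<Delta>'" using assms(2) by blast
  with assms(3) have "?\<Delta>' \<subseteq> \<Delta> \<and> ?\<Delta>' \<noteq> {}" by auto
  with assms(1) obtain g \<phi> \<psi> where g: "g \<in> objects K" "object_sat_all K g ?\<Delta>'"
    "Defeasible \<phi> \<psi> \<in> ?\<Delta>'" "g \<in> extent K \<phi>"
    unfolding valid_context_def by meson
  have "satisfies_all K g E"
    using g(2) assms(2) unfolding object_sat_all_def satisfies_all_def by fastforce
  with g show thesis by (intro that[of g "Imp \<phi> \<psi>"]) auto
qed

text \<open>Validity, applied to the residual itself, yields an object satisfying it together with
  one of its antecedents. A level below \<open>k\<close> would make that antecedent false, and round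
  \<open>k\<close> discards the implication. The object serves convexity, the implication
  termination.\<close>

lemma level_attained:
  assumes "valid_context \<Delta> K" "residual K (material ` \<Delta>) k \<noteq> {}"
  obtains g c where "g \<in> objects K" "level K (material ` \<Delta>) g = k"
    "c \<in> residual K (material ` \<Delta>) k" "c \<notin> residual K (material ` \<Delta>) (Suc k)"
proof -
  let ?D = "material ` \<Delta>"
  have "residual K ?D k \<subseteq> ?D" using residual_antimono[of 0 k K ?D] by simp
  then obtain g c where g: "g \<in> objects K" "satisfies_all K g (residual K ?D k)"
    "c \<in> residual K ?D k" "g \<in> extent K (antecedent c)"
    using valid_context_implications assms by metis
  have "\<not> level K ?D g < k"
    using antecedent_false_if_residual[OF g(1) level_satisfies[OF g(2)] _ g(3)] g(4) by blast
  with level_le[OF g(2)] have "level K ?D g = k" by simp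
  with g that show thesis by auto
qed

lemma residual_eventually_empty:
  assumes "finite \<Delta>" "valid_context \<Delta> K"
  shows "\<exists>k. residual K (material ` \<Delta>) k = {}"
proof (rule ccontr)
  let ?D = "material ` \<Delta>"
  assume "\<not> ?thesis"
  then have strict: "residual K ?D (Suc k) \<subset> residual K ?D k" for k
    using level_attained[OF assms(2), of k] residual_antimono[of k "Suc k" K ?D]
    by (metis lessI less_imp_le psubsetI)
  have fin: "finite (residual K ?D k)" for k
    using residual_antimono[of 0 k K ?D] assms(1) by (auto intro: finite_subset)
  \<comment> \<open>Each round costs at least one implication, so the residuals cannot stay nonempty
    for more than \<open>card ?D\<close> rounds.\<close>
  have "card (residual K ?D k) + k \<le> card ?D" for k
  proof (induction k)
    case (Suc k)
    with psubset_card_mono[OF fin strict, of k] show ?case by linarith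
  qed simp
  from this[of "Suc (card ?D)"] show False by simp
qed

text \<open>Closed form of the loop state after \<open>i\<close> rounds. Entry \<open>i\<close> is
  not yet split and holds all unplaced objects, whence the guard \<open>j < i\<close>. The empty
  entries beyond \<open>i\<close> agree with \<open>or_init\<close>, so that states can be equated
  as functions.\<close>

definition or_state_at ::
  "('g, 'm) formal_context \<Rightarrow> 'm implication set \<Rightarrow> nat \<Rightarrow> ('g, 'm) or_state" where
  "or_state_at K D i =
    (i,
     \<lambda>j. if j \<le> i then
           {g \<in> objects K. (\<forall>l<j. \<not> satisfies_all K g (residual K D l)) \<and>
                           (j < i \<longrightarrow> satisfies_all K g (residual K D j))}
         else {},
     \<lambda>j. if j \<le> i then residual K D j else {})"

text \<open>An object that satisfies an earlier residual falsifies every antecedent left in residual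
  \<open>i\<close>, so only unplaced objects can discard anything.\<close>

lemma residual_Suc_unplaced:
  "residual K D (Suc i) =
    residual K D i - {c \<in> residual K D i. \<exists>g\<in>{g \<in> objects K.
      (\<forall>l<i. \<not> satisfies_all K g (residual K D l)) \<and> satisfies_all K g (residual K D i)}.
      g \<in> extent K (antecedent c)}"
  using antecedent_false_if_residual[of _ K D _ i] by auto

lemma or_step_state_at: "or_step K (or_state_at K D i) = or_state_at K D (Suc i)"
proof -
  define P where "P j g \<longleftrightarrow> satisfies_all K g (residual K D j)" for j g
  have fail: "(\<exists>c\<in>residual K D i. \<not> object_sat K g c) \<longleftrightarrow> \<not> P i g" for g
    by (auto simp: P_def satisfies_all_def)
  \<comment> \<open>The left side is the updated \<open>R_i\<close> as \<open>or_step\<close>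
    computes it, the right side is entry \<open>i\<close> of the next state.\<close>
  have cur: "{g \<in> objects K. \<forall>l<i. \<not> P l g} - {g \<in> {g \<in> objects K. \<forall>l<i. \<not> P l g}. \<not> P i g}
      = {g \<in> objects K. (\<forall>l<i. \<not> P l g) \<and> P i g}"
    by blast
  show ?thesis
    unfolding or_step_def or_state_at_def Let_def prod.case
    apply (simp only: fail le_refl if_True less_irrefl simp_thms P_def[symmetric] cur)
    using residual_Suc_unplaced[of K D i, folded P_def]
    by (auto simp: fun_eq_iff le_Suc_eq less_Suc_eq P_def[symmetric] simp del: residual.simps(2))
qed

lemma funpow_or_step: "(or_step K ^^ i) (or_init K \<Delta>) = or_state_at K (material ` \<Delta>) i"
proof (induction i)
  case 0
  then show ?case by (auto simp: or_init_def or_state_at_def fun_eq_iff)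
qed (simp add: or_step_state_at)

lemma or_ranked_context_state_at:
  assumes "residual K D n = {}"
  shows "or_ranked_context K (or_state_at K D n) =
    \<lparr>objects = objects K, attributes = attributes K, incidence = incidence K,
     rank = restrict (level K D) (objects K)\<rparr>"
proof -
  define R where "R = fst (snd (or_state_at K D n))"
  have "(THE k. k \<le> n \<and> g \<in> R k) = level K D g" if g: "g \<in> objects K" for g
  proof (rule the_equality)
    have sat: "satisfies_all K g (residual K D n)" by (simp add: assms)
    show "level K D g \<le> n \<and> g \<in> R (level K D g)"
      using level_le[OF sat] level_satisfies[OF sat] g level_le[of K g D]
      by (auto simp: R_def or_state_at_def simp flip: not_le)
  next
    fix k assume k: "k \<le> n \<and> g \<in> R k"
    \<comment> \<open>The last entry does not record satisfaction, but for \<open>k = n\<close> the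
      residual is empty.\<close>
    then have "satisfies_all K g (residual K D k)"
      using assms by (cases "k = n") (auto simp: R_def or_state_at_def)
    moreover have "\<forall>l<k. \<not> satisfies_all K g (residual K D l)"
      using k by (auto simp: R_def or_state_at_def)
    ultimately show "k = level K D g"
      by (metis level_le level_satisfies le_neq_implies_less)
  qed
  then have "(\<lambda>g\<in>objects K. THE k. k \<le> n \<and> g \<in> R k) = restrict (level K D) (objects K)"
    by (rule restrict_ext)
  then show ?thesis
    by (simp add: or_ranked_context_def or_state_at_def R_def)
qed

lemma object_rank_eq:
  assumes "finite \<Delta>" "valid_context \<Delta> K"
  shows "object_rank K \<Delta> = Some
    \<lparr>objects = objects K, attributes = attributes K, incidence = incidence K,
     rank = restrict (level K (material ` \<Delta>)) (objects K)\<rparr>"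
proof -
  let ?D = "material ` \<Delta>"
  \<comment> \<open>By definition \<open>while_option\<close> returns the iterate at the least index
    where the loop condition fails, which is \<open>?n\<close>.\<close>
  let ?n = "LEAST k. residual K ?D k = {}"
  have ex: "\<exists>k. residual K ?D k = {}" by (rule residual_eventually_empty[OF assms])
  have "or_continue (or_state_at K ?D k) \<longleftrightarrow> residual K ?D k \<noteq> {}" for k
    by (simp add: or_continue_def or_state_at_def)
  with ex have "while_option or_continue (or_step K) (or_init K \<Delta>) = Some (or_state_at K ?D ?n)"
    by (simp add: while_option_def funpow_or_step)
  moreover have "residual K ?D ?n = {}" using ex by (rule LeastI_ex)
  ultimately show ?thesis
    by (simp add: object_rank_def or_ranked_context_state_at)
qed

lemma level_context_in_ranked_models:
  assumes "is_formal_context K" "finite \<Delta>" "valid_context \<Delta> K"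
  shows "\<lparr>objects = objects K, attributes = attributes K, incidence = incidence K,
     rank = restrict (level K (material ` \<Delta>)) (objects K)\<rparr> \<in> ranked_models K \<Delta>"
    (is "?R \<in> _")
proof -
  let ?D = "material ` \<Delta>"
  have trunc: "formal_context.truncate ?R = K"
    by (simp add: formal_context.truncate_def)
  have ext: "extent ?R \<phi> = extent K \<phi>" for \<phi>
    using extent_truncate[of ?R \<phi>] by (simp only: trunc)
  obtain n where n: "residual K ?D n = {}" using residual_eventually_empty[OF assms(2,3)] by blast
  have sat: "satisfies_all K g (residual K ?D (level K ?D g))" for g
    by (rule level_satisfies[of K g ?D n]) (simp add: n)
  have convex: "\<exists>h\<in>objects K. level K ?D h = j" if "j < level K ?D g" for g j
  proof -
    \<comment> \<open>An empty residual would be satisfied by \<open>g\<close> and so bound its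
      level by \<open>j\<close>.\<close>
    have "residual K ?D j \<noteq> {}"
      using level_le[of K g ?D j] that by fastforce
    then show ?thesis using level_attained[OF assms(3)] by metis
  qed
  have "ranked_sat ?R (Defeasible \<phi> \<psi>)" if c: "Defeasible \<phi> \<psi> \<in> \<Delta>" for \<phi> \<psi>
    unfolding ranked_sat.simps ext
  proof (intro allI impI)
    fix g assume min: "is_arg_min (rank ?R) (\<lambda>h. h \<in> extent K \<phi>) g"
    then have g: "g \<in> extent K \<phi>" "g \<in> objects K"
      using extent_subset_objects[OF assms(1)] by (auto simp: is_arg_min_def)
    have D: "Imp \<phi> \<psi> \<in> ?D" using c by force
    \<comment> \<open>Otherwise the object that expelled the implication would satisfy
      \<open>\<phi>\<close> at a level below that of \<open>g\<close>, against minimality.\<close>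
    have "Imp \<phi> \<psi> \<in> residual K ?D (level K ?D g)"
    proof (rule ccontr)
      assume "\<not> ?thesis"
      from removed_witness[OF D this] obtain j h where h: "j < level K ?D g" "h \<in> objects K"
        "satisfies_all K h (residual K ?D j)" "h \<in> extent K \<phi>" by auto
      then have "rank ?R h < rank ?R g" using level_le[OF h(3)] g by simp
      with min h(4) show False by (auto simp: is_arg_min_def)
    qed
    with sat[of g] g show "g \<in> extent K \<psi>"
      by (auto simp: satisfies_all_def)
  qed
  then have "\<forall>c\<in>\<Delta>. ranked_sat ?R c" by (metis conditional.exhaust)
  moreover have "is_ranked_context ?R"
    using assms(1) convex by (auto simp: is_ranked_context_def is_formal_context_def)
  ultimately show ?thesis using trunc by (simp add: ranked_models_def)
qed

text \<open>Combined with \<open>level_le\<close>, this bounds the level of \<open>g\<close> by its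
  rank in any model, which is the minimality claim.\<close>

lemma ranked_model_satisfies_residual:
  assumes "is_formal_context K" "R \<in> ranked_models K \<Delta>"
  shows "satisfies_all K g (residual K (material ` \<Delta>) (rank R g))"
proof (induction "rank R g" arbitrary: g rule: less_induct)
  case less
  let ?D = "material ` \<Delta>"
  have ext: "extent R \<phi> = extent K \<phi>" for \<phi>
    using assms(2) extent_truncate[of R \<phi>] by (auto simp: ranked_models_def)
  show ?case unfolding satisfies_all_def
  proof (rule ballI, rule ccontr)
    fix c assume c: "c \<in> residual K ?D (rank R g)" and "\<not> object_sat K g c"
    then have g: "g \<in> extent K (antecedent c)" "g \<notin> extent K (consequent c)"
      by (auto simp: object_sat_iff)
    from c have "c \<in> ?D" using residual_antimono[of 0 "rank R g" K ?D] by auto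
    then obtain \<phi> \<psi> where \<Delta>: "Defeasible \<phi> \<psi> \<in> \<Delta>" "c = Imp \<phi> \<psi>"
      by (metis image_iff material.simps conditional.exhaust)
    then have "ranked_sat R (Defeasible \<phi> \<psi>)" using assms(2) by (auto simp: ranked_models_def)
    with g \<Delta>(2) have "\<not> is_arg_min (rank R) (\<lambda>h. h \<in> extent K \<phi>) g" by (auto simp: ext)
    with g \<Delta>(2) obtain h where h: "h \<in> extent K \<phi>" "rank R h < rank R g"
      by (auto simp: is_arg_min_def)
    have "h \<in> objects K" using h(1) extent_subset_objects[OF assms(1)] by blast
    from antecedent_false_if_residual[OF this less[OF h(2)] h(2) c] h(1) \<Delta>(2)
    show False by simp
  qed
qed

text \<open>Uniqueness of the minimum rests on this. The order compares ranks on objects only;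
  \<open>extensional\<close> settles the values elsewhere, and truncation to the same
  \<open>K\<close> the other fields.\<close>

lemma rank_le_antisym:
  assumes "R \<in> ranked_models K \<Delta>" "R' \<in> ranked_models K \<Delta>" "R \<preceq>\<^sub>R R'" "R' \<preceq>\<^sub>R R"
  shows "R = R'"
proof -
  have tr: "formal_context.truncate R = K" "formal_context.truncate R' = K"
    and ext: "rank R \<in> extensional (objects R)" "rank R' \<in> extensional (objects R')"
    using assms(1,2) by (auto simp: ranked_models_def is_ranked_context_def)
  from tr have eqs: "objects R = objects R'" "attributes R = attributes R'"
    "incidence R = incidence R'"
    by (auto simp: formal_context.truncate_def)
  have "rank R = rank R'"
    using ext assms(3,4) eqs
    by (intro extensionalityI[of _ "objects R"]) (auto simp: rank_le_def intro: antisym)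
  with eqs show ?thesis by (intro ranked_context.equality) auto
qed

theorem proposition3:
  fixes K :: "('g, 'm) formal_context" and \<Delta> :: "'m conditional set"
  assumes "is_formal_context K"
    and "finite \<Delta>"
    and "\<Delta> \<subseteq> conditionals (attributes K)"
    and "valid_context \<Delta> K"
  shows "\<exists>R_OR. object_rank K \<Delta> = Some R_OR \<and>
    R_OR \<in> ranked_models K \<Delta> \<and>
    (\<forall>R1\<in>ranked_models K \<Delta>. R_OR \<preceq>\<^sub>R R1) \<and>
    (\<forall>R\<in>ranked_models K \<Delta>. (\<forall>R1\<in>ranked_models K \<Delta>. R \<preceq>\<^sub>R R1) \<longrightarrow> R = R_OR)"
proof -
  let ?R = "\<lparr>objects = objects K, attributes = attributes K, incidence = incidence K,
     rank = restrict (level K (material ` \<Delta>)) (objects K)\<rparr>"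
  have mem: "?R \<in> ranked_models K \<Delta>"
    by (rule level_context_in_ranked_models[OF assms(1,2,4)])
  have min: "?R \<preceq>\<^sub>R R1" if "R1 \<in> ranked_models K \<Delta>" for R1
    using level_le[OF ranked_model_satisfies_residual[OF assms(1) that]]
    by (simp add: rank_le_def)
  show ?thesis
    using object_rank_eq[OF assms(2,4)] mem min rank_le_antisym by blast
qed

end
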